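(* Let $K$ be a compact Hausdorff space and let $M\subseteq K$ be a subspace which is Polish in the relative topology. Then $M$ is a strongly $\mathcal{K}_{\sigma\delta}$ subset of $K$.
   Context: All topological spaces are Hausdorff and completely regular. A subset $A$ of a topological space $X$ is called strongly $\mathcal{K}_{\sigma\delta}$ if there is a countable family $\{K_{n,m}: n,m\in\mathbb{N}\}$ of compact subsets of $X$ such that (i) $A=\bigcap_{n=1}^\infty\bigcup_{m=1}^\infty K_{n,m}$, and (ii) for each compact subset $L$ of $A$ and each $n\in\mathbb{N}$ there exists $m\in\mathbb{N}$ with $L\subseteq K_{n,m}$. A Polish space is a topological space homeomorphic to a complete separable metric space. *)

theory Defs
  imports "HOL-Analysis.Analysis"
begin

text \<open>The witness \<open>Y\<close> lives on the same type as \<open>X\<close> only because HOL cannot quantify over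
  types; the lemma after the definition shows that a complete separable metric space on any other
  type serves equally well.\<close>

definition Polish_space :: "'a topology \<Rightarrow> bool" where
  "Polish_space X \<longleftrightarrow>
     (\<exists>Y :: 'a topology. completely_metrizable_space Y \<and> separable_space Y \<and> X homeomorphic_space Y)"

lemma Polish_spaceI:
  fixes X :: "'a topology" and Y :: "'b topology"
  assumes "completely_metrizable_space Y" "separable_space Y" "X homeomorphic_space Y"
  shows "Polish_space X"
  unfolding Polish_space_def
  using assms homeomorphic_completely_metrizable_space homeomorphic_separable_space
    homeomorphic_space_refl by blast

definition strongly_K_sigma_delta :: "'a topology \<Rightarrow> 'a set \<Rightarrow> bool" where
  "strongly_K_sigma_delta X A \<longleftrightarrow>
     A \<subseteq> topspace X \<and>
     (\<exists>K :: nat \<Rightarrow> nat \<Rightarrow> 'a set.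
        (\<forall>n m. compactin X (K n m)) \<and>
        A = (\<Inter>n. \<Union>m. K n m) \<and>
        (\<forall>L n. compactin X L \<and> L \<subseteq> A \<longrightarrow> (\<exists>m. L \<subseteq> K n m)))"

end

theory Submission
  imports Defs
begin

text \<open>Fix a complete metric on \<open>M\<close>. By the Lindelof property, for every \<open>n\<close> countably many open
  sets \<open>V n j\<close> of \<open>K\<close> cover \<open>M\<close> such that the closure of each lies in an open set whose trace on
  \<open>M\<close> is contained in a ball of radius \<open>1 / (n + 1)\<close>. Put
  \<open>C n m = closure M \<inter> (\<Union>j\<le>m. closure (V n j))\<close>. A point lying in \<open>\<Union>m. C n m\<close> for all \<open>n\<close> is a
  limit of \<open>M\<close> whose neighbourhood traces on \<open>M\<close> form a Cauchy filter, so by completeness it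
  belongs to \<open>M\<close>.\<close>

text \<open>The balls of radius \<open>1 / (n + 1)\<close> around the points of a countable dense
  set form a countable base. This supplies the Lindelof property of \<open>M\<close>.\<close>

lemma (in Metric_space) separable_imp_second_countable:
  assumes "separable_space mtopology"
  shows "second_countable mtopology"
proof -
  obtain C where C: "countable C" "C \<subseteq> M" "mtopology closure_of C = M"
    using assms unfolding separable_space_def by auto
  let ?B = "(\<lambda>(c, n). mball c (inverse (Suc n))) ` (C \<times> (UNIV :: nat set))"
  have "\<exists>V\<in>?B. x \<in> V \<and> V \<subseteq> U" if U: "openin mtopology U" "x \<in> U" for U x
  proof -
    obtain r where r: "r > 0" "mball x r \<subseteq> U"
      using U unfolding openin_mtopology by blast
    have x: "x \<in> M"
      using U openin_mtopology by blast
    \<comment> \<open>Half of \<open>r\<close> suffices: a point of the ball around \<open>c\<close>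
      reaches \<open>x\<close> via \<open>c\<close> in two steps, each shorter than
      \<open>r / 2\<close>.\<close>
    obtain n where n: "inverse (real (Suc n)) < r / 2"
      using reals_Archimedean r(1) half_gt_zero by blast
    have "\<forall>r>0. \<exists>c\<in>C. c \<in> mball x r"
      using x C(3) unfolding metric_closure_of by blast
    moreover have "inverse (real (Suc n)) > 0"
      by simp
    ultimately obtain c where c: "c \<in> C" "c \<in> mball x (inverse (Suc n))"
      by blast
    have "mball c (inverse (Suc n)) \<subseteq> mball x r"
    proof
      fix y assume y: "y \<in> mball c (inverse (Suc n))"
      then have "d x y \<le> d x c + d c y"
        using c x by (intro triangle) auto
      with y c n show "y \<in> mball x r"
        by auto
    qed
    moreover have "x \<in> mball c (inverse (Suc n))"
      using c x by (auto simp: commute)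
    ultimately show ?thesis
      using c(1) r(2) by (auto intro!: bexI[of _ "(c, n)"])
  qed
  moreover have "countable ?B"
    using C(1) by auto
  ultimately show ?thesis
    unfolding second_countable_def by (intro exI[of _ ?B]) auto
qed

text \<open>The closures in \<open>M\<close> of the traces of neighbourhoods of \<open>p\<close>
  have the finite intersection property and become arbitrarily small, so completeness gives them a
  common point \<open>q\<close>; separation in \<open>X\<close> then forces
  \<open>p = q\<close>.\<close>

lemma (in Metric_space) mem_if_small_neighbourhood_traces:
  assumes haus: "Hausdorff_space X"
    and top: "subtopology X M = mtopology"
    and complete: mcomplete
    and p: "p \<in> X closure_of M"
    and small: "\<And>e. e > 0 \<Longrightarrow> \<exists>T a. openin X T \<and> p \<in> T \<and> T \<inter> M \<subseteq> mcball a e"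
  shows "p \<in> M"
proof -
  let ?N = "{T. openin X T \<and> p \<in> T}"
  let ?C = "(\<lambda>T. mtopology closure_of (T \<inter> M)) ` ?N"
  have "\<Inter>?C \<noteq> {}"
  proof -
    have "\<exists>C a. C \<in> ?C \<and> C \<subseteq> mcball a e" if "e > 0" for e
    proof -
      obtain T a where "openin X T" "p \<in> T" "T \<inter> M \<subseteq> mcball a e"
        using small \<open>e > 0\<close> by blast
      moreover from this have "mtopology closure_of (T \<inter> M) \<subseteq> mcball a e"
        by (intro closure_of_minimal closedin_mcball)
      ultimately show ?thesis
        by blast
    qed
    moreover have "\<Inter>\<F> \<noteq> {}" if F: "finite \<F>" "\<F> \<subseteq> ?C" for \<F>
    proof -
      obtain \<T> where T: "finite \<T>" "\<T> \<subseteq> ?N" "\<F> = (\<lambda>T. mtopology closure_of (T \<inter> M)) ` \<T>"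
        using finite_subset_image[OF F] by blast
      \<comment> \<open>Inserting \<open>topspace X\<close> keeps the intersection open when
        \<open>\<T>\<close> is empty.\<close>
      let ?T = "\<Inter>(insert (topspace X) \<T>)"
      have "openin X ?T"
        using T(1,2) by (intro openin_Inter) auto
      moreover have "p \<in> ?T"
        using T(2) p in_closure_of by fastforce
      ultimately obtain y where y: "y \<in> M" "y \<in> ?T"
        using p in_closure_of by metis
      have "y \<in> mtopology closure_of (T \<inter> M)" if "T \<in> \<T>" for T
        using y that closure_of_subset[of "T \<inter> M" mtopology] by auto
      then show ?thesis
        using T(3) by blast
    qed
    ultimately show ?thesis
      using complete[unfolded mcomplete_fip, rule_format, of ?C] by auto
  qed
  then obtain q where q: "\<And>T. openin X T \<Longrightarrow> p \<in> T \<Longrightarrow> q \<in> mtopology closure_of (T \<inter> M)"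
    by blast
  have pX: "p \<in> topspace X"
    using p in_closure_of by metis
  have qM: "q \<in> M"
    using q[OF openin_topspace pX] closure_of_subset_topspace[of mtopology] by fastforce
  have "p = q"
  proof (rule ccontr)
    assume "p \<noteq> q"
    moreover have "q \<in> topspace X"
      using qM arg_cong[OF top, of topspace] by auto
    ultimately obtain P Q where PQ: "openin X P" "openin X Q" "p \<in> P" "q \<in> Q" "disjnt P Q"
      using haus pX unfolding Hausdorff_space_def by blast
    \<comment> \<open>This neighbourhood of \<open>q\<close> would have to meet
      \<open>P \<inter> M\<close>, although \<open>P\<close> and \<open>Q\<close> are
      disjoint.\<close>
    have "openin mtopology (Q \<inter> M)"
      using openin_subtopology_Int[OF PQ(2), of M] top by simp
    then show False
      using q[OF PQ(1,3)] PQ qM unfolding in_closure_of disjnt_iff by blast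
  qed
  with qM show ?thesis by simp
qed

theorem theorem1p11:
  fixes K :: "'a topology" and M :: "'a set"
  assumes "compact_space K"
    and "Hausdorff_space K"
    and "M \<subseteq> topspace K"
    and "Polish_space (subtopology K M)"
  shows "strongly_K_sigma_delta K M"
proof -
  have "completely_metrizable_space (subtopology K M)" and sep: "separable_space (subtopology K M)"
    using assms(4) homeomorphic_completely_metrizable_space homeomorphic_separable_space
    unfolding Polish_space_def by blast+
  then obtain M' d where M': "Metric_space M' d" "Metric_space.mcomplete M' d"
    "subtopology K M = Metric_space.mtopology M' d"
    unfolding completely_metrizable_space_def by blast
  then have "M' = M"
    using assms(3) Metric_space.topspace_mtopology topspace_subtopology_subset by metis
  interpret D: Metric_space M d
    using M'(1) \<open>M' = M\<close> by simp
  have complete: D.mcomplete and top: "subtopology K M = D.mtopology"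
    using M' \<open>M' = M\<close> by simp_all
  have Lindelof: "Lindelof_space (subtopology K M)"
    using sep D.separable_imp_second_countable second_countable_imp_Lindelof_space top by metis
  have reg: "neighbourhood_base_of (closedin K) K"
    using assms(1,2) compact_Hausdorff_imp_regular_space neighbourhood_base_of_closedin by blast
  \<comment> \<open>The open set \<open>U\<close> around the closure gives every point of
    \<open>K closure_of V\<close>, even one outside \<open>M\<close>, a neighbourhood with small
    trace on \<open>M\<close>.\<close>
  define small where "small e V \<longleftrightarrow> openin K V \<and>
      (\<exists>U a. openin K U \<and> K closure_of V \<subseteq> U \<and> U \<inter> M \<subseteq> D.mcball a e)" for e V
  have "\<exists>V :: nat \<Rightarrow> 'a set. (\<forall>j. small e (V j)) \<and> M \<subseteq> (\<Union>j. V j)" if "e > 0" for e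
  proof -
    have "\<exists>V. small e V \<and> x \<in> V" if x: "x \<in> M" for x
    proof -
      have "openin (subtopology K M) (D.mball x e)"
        by (simp add: top)
      then obtain U where U: "openin K U" "D.mball x e = U \<inter> M"
        using openin_subtopology by metis
      with x \<open>e > 0\<close> have "x \<in> U"
        using D.centre_in_mball_iff[of x e] by auto
      with U(1) obtain V C where "openin K V" "closedin K C" "x \<in> V" "V \<subseteq> C" "C \<subseteq> U"
        using reg unfolding neighbourhood_base_of by meson
      moreover from this have "K closure_of V \<subseteq> U"
        using closure_of_minimal by (metis subset_trans)
      moreover have "U \<inter> M \<subseteq> D.mcball x e"
        using U(2) D.mball_subset_mcball by metis
      ultimately show ?thesis
        unfolding small_def using U(1) by blast
    qed
    then have "M \<subseteq> \<Union>(Collect (small e))"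
      by blast
    moreover have "\<forall>V\<in>Collect (small e). openin K V"
      by (simp add: small_def)
    ultimately obtain \<V> where V: "countable \<V>" "\<V> \<subseteq> Collect (small e)" "M \<subseteq> \<Union>\<V>"
      using Lindelof unfolding Lindelof_space_subtopology_subset[OF assms(3)] by meson
    \<comment> \<open>Adding the empty set makes the countable family nonempty, so
      \<open>from_nat_into\<close> enumerates exactly this family even if \<open>\<V>\<close> is
      empty.\<close>
    have "small e {}"
      unfolding small_def by (auto intro!: exI[of _ "{}"])
    then have "range (from_nat_into (insert {} \<V>)) \<subseteq> Collect (small e)"
      using V(1,2) by (subst range_from_nat_into) auto
    moreover have "M \<subseteq> \<Union>(range (from_nat_into (insert {} \<V>)))"
      using V(1,3) by (subst range_from_nat_into) auto
    ultimately show ?thesis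
      by (intro exI[of _ "from_nat_into (insert {} \<V>)"]) blast
  qed
  then have "\<exists>V :: nat \<Rightarrow> 'a set. (\<forall>j. small (inverse (Suc n)) (V j)) \<and> M \<subseteq> (\<Union>j. V j)" for n
    by simp
  then obtain V :: "nat \<Rightarrow> nat \<Rightarrow> 'a set"
    where V: "\<And>n j. small (inverse (Suc n)) (V n j)" and cover: "\<And>n. M \<subseteq> (\<Union>j. V n j)"
    by metis
  \<comment> \<open>Unions over \<open>j \<le> m\<close>, rather than single closures, make
    \<open>C n m\<close> increase with \<open>m\<close>; this lets one \<open>C n m\<close> contain
    a given compact subset of \<open>M\<close>.\<close>
  define C where "C n m = K closure_of M \<inter> (\<Union>j\<le>m. K closure_of V n j)" for n m
  have open_V: "openin K (V n j)" for n j
    using V small_def by blast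
  have V_sub: "V n j \<subseteq> K closure_of V n j" for n j
    by (simp add: closure_of_subset open_V openin_subset)
  have M_sub: "M \<subseteq> K closure_of M"
    by (simp add: assms(3) closure_of_subset)
  have "compactin K (C n m)" for n m
    unfolding C_def
    by (intro closedin_compact_space[OF assms(1)] closedin_Int closedin_Union) auto
  moreover have "M = (\<Inter>n. \<Union>m. C n m)"
  proof
    show "M \<subseteq> (\<Inter>n. \<Union>m. C n m)"
    proof
      fix x assume "x \<in> M"
      have "\<exists>m. x \<in> C n m" for n
      proof -
        obtain j where "x \<in> V n j"
          using cover \<open>x \<in> M\<close> by blast
        then have "x \<in> C n j"
          unfolding C_def using V_sub M_sub \<open>x \<in> M\<close> by blast
        then show ?thesis ..
      qed
      then show "x \<in> (\<Inter>n. \<Union>m. C n m)"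
        by blast
    qed
    show "(\<Inter>n. \<Union>m. C n m) \<subseteq> M"
    proof
      fix p assume p: "p \<in> (\<Inter>n. \<Union>m. C n m)"
      \<comment> \<open>For \<open>1 / (n + 1) < e\<close>, the point \<open>p\<close> lies in the
        closure of some \<open>V n j\<close>, and the set \<open>U\<close> from \<open>small\<close>
        serves as \<open>T\<close>.\<close>
      have "\<exists>T a. openin K T \<and> p \<in> T \<and> T \<inter> M \<subseteq> D.mcball a e" if "e > 0" for e
      proof -
        obtain n where n: "inverse (real (Suc n)) < e"
          using reals_Archimedean \<open>e > 0\<close> by blast
        obtain j where "p \<in> K closure_of V n j"
          using p unfolding C_def by blast
        then obtain U a where "openin K U" "p \<in> U" "U \<inter> M \<subseteq> D.mcball a (inverse (Suc n))"
          using V[of n j] unfolding small_def by blast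
        moreover have "D.mcball a (inverse (Suc n)) \<subseteq> D.mcball a e"
          using n by (intro D.mcball_subset_concentric) auto
        ultimately show ?thesis
          by (meson subset_trans)
      qed
      moreover have "p \<in> K closure_of M"
        using p unfolding C_def by auto
      ultimately show "p \<in> M"
        using D.mem_if_small_neighbourhood_traces[OF assms(2) top complete] by blast
    qed
  qed
  moreover have "\<exists>m. L \<subseteq> C n m" if L: "compactin K L" "L \<subseteq> M" for L n
  proof -
    have "L \<subseteq> \<Union>(range (V n))"
      using L(2) cover[of n] by simp
    then obtain \<F> where F: "finite \<F>" "\<F> \<subseteq> range (V n)" "L \<subseteq> \<Union>\<F>"
      using compactinD[OF L(1), of "range (V n)"] open_V by auto
    obtain J where J: "finite J" "L \<subseteq> (\<Union>j\<in>J. V n j)"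
      using finite_subset_image[OF F(1,2)] F(3) by auto
    \<comment> \<open>Compactness left only finitely many indices, so a common bound
      \<open>m\<close> works.\<close>
    from J(1) obtain m where "J \<subseteq> {..m}"
      unfolding finite_nat_set_iff_bounded_le by auto
    then have "(\<Union>j\<in>J. V n j) \<subseteq> (\<Union>j\<le>m. K closure_of V n j)"
      by (intro UN_mono V_sub)
    then have "L \<subseteq> C n m"
      unfolding C_def using J(2) L(2) M_sub by (intro Int_greatest) (rule subset_trans, assumption+)+
    then show ?thesis ..
  qed
  ultimately show ?thesis
    unfolding strongly_K_sigma_delta_def using assms(3) by (intro conjI exI[of _ C]) auto
qed

end
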